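(* Fix integers $n,r,k$ with $1<r\leq k$ and let $t=\lfloor 2k/r\rfloor$. Suppose that for every integer $N\geq 1$ a $(t,k)$-minimal separating family $\mathcal{H}_N$ of functions $[N]\to[t+1]$ can be constructed (deterministically) in time $f(r,k,N)$. Then an $(r,k)$-separator $\mathcal{F}$ over universe $[n]$ of size $|\mathcal{H}_{\max(n,t)}|\cdot (r+1)^t$ can be constructed in time $k^{O(1)}\cdot f(r,k,\max(n,t))\cdot (r+1)^t$.
   Context: $[n]=\{1,\ldots,n\}$. A family $\mathcal{H}$ of functions $[N]\to[t+1]$ is \emph{$(t,k)$-minimal separating} if for every pair of disjoint $C,D\subseteq[N]$ with $|C|=t$ and $|D|\leq k-t$ there is $h\in\mathcal{H}$ with $h(C)=[t]$ and $h(D)\subseteq\{t+1\}$. An \emph{$r$-set} is a vector $A\in\{0,\ldots,r\}^n$ (a multiset over $[n]$ in which element $i$ appears $A_i\le r$ times); its size is $|A|=\sum_i A_i$; an \emph{$(r,k)$-set} is an $r$-set of size at most $k$. For $r$-sets, $A\leq B$ means $A_i\le B_i$ for all $i$; $\bar{A}$ is defined by $\bar{A}_i=r-A_i$; $(A+B)_i=A_i+B_i$. Two $(r,k)$-sets $A,B$ are \emph{$(r,k)$-compatible} if $A+B$ is an $(r,k)$-set (i.e. $A_i+B_i\le r$ for all $i$) and $|A+B|=k$. A family $\mathcal{F}$ of $r$-sets is an \emph{$(r,k)$-separator} if for all $(r,k)$-compatible $(r,k)$-sets $A,B$ there is $F\in\mathcal{F}$ with $A\leq F\leq \bar{B}$.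 *)

theory Defs
  imports Complex_Main "HOL-Library.FuncSet"
begin

text \<open>
  Model of computation: deterministic unit-cost random access machines in the style of Cook and
  Reckhow (natural numbers, addition and truncated subtraction, indirect addressing, a write-only
  output tape), programmed by structured programs. There is an unlimited supply of registers and
  of zero-initialised memories, but a program mentions only finitely many of them, so that
  interleaving the memories turns it into a program for a single memory at the price of a
  constant factor. There is no unit-cost multiplication.
\<close>

record state =
  reg :: "nat \<Rightarrow> nat"
  mem :: "nat \<Rightarrow> nat \<Rightarrow> nat"
  out :: "nat list"

datatype prog =
    Skip
  | SetC nat nat         \<comment> \<open>\<open>SetC x c\<close>: register \<open>x\<close> gets the constant \<open>c\<close>\<close>
  | Copy nat nat
  | Add nat nat nat      \<comment> \<open>\<open>Add x y z\<close>: register \<open>x\<close> gets \<open>y + z\<close>\<close>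
  | Sub nat nat nat
  | Load nat nat nat     \<comment> \<open>\<open>Load x a y\<close>: register \<open>x\<close> gets cell number (register \<open>y\<close>) of memory \<open>a\<close>\<close>
  | Store nat nat nat    \<comment> \<open>\<open>Store a x y\<close>: cell number (register \<open>x\<close>) of memory \<open>a\<close> gets register \<open>y\<close>\<close>
  | Output nat
  | Seq prog prog
  | IfNZ nat prog prog
  | WhileNZ nat prog

definition set_reg :: "nat \<Rightarrow> nat \<Rightarrow> state \<Rightarrow> state" where
  "set_reg x v s = s\<lparr>reg := (reg s)(x := v)\<rparr>"

definition set_mem :: "nat \<Rightarrow> nat \<Rightarrow> nat \<Rightarrow> state \<Rightarrow> state" where
  "set_mem a i v s = s\<lparr>mem := (mem s)(a := (mem s a)(i := v))\<rparr>"

text \<open>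
  \<open>exec p s m s'\<close>: started in \<open>s\<close>, the program \<open>p\<close> halts in \<open>s'\<close> after exactly \<open>m\<close> steps, where
  every elementary instruction and every evaluation of a guard is one step.
\<close>

inductive exec :: "prog \<Rightarrow> state \<Rightarrow> nat \<Rightarrow> state \<Rightarrow> bool" where
  Skip:   "exec Skip s 1 s"
| SetC:   "exec (SetC x c) s 1 (set_reg x c s)"
| Copy:   "exec (Copy x y) s 1 (set_reg x (reg s y) s)"
| Add:    "exec (Add x y z) s 1 (set_reg x (reg s y + reg s z) s)"
| Sub:    "exec (Sub x y z) s 1 (set_reg x (reg s y - reg s z) s)"
| Load:   "exec (Load x a y) s 1 (set_reg x (mem s a (reg s y)) s)"
| Store:  "exec (Store a x y) s 1 (set_mem a (reg s x) (reg s y) s)"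
| Output: "exec (Output x) s 1 (s\<lparr>out := out s @ [reg s x]\<rparr>)"
| Seq:    "exec p s l s' \<Longrightarrow> exec q s' m s'' \<Longrightarrow> exec (Seq p q) s (l + m) s''"
| IfT:    "reg s x \<noteq> 0 \<Longrightarrow> exec p s m s' \<Longrightarrow> exec (IfNZ x p q) s (1 + m) s'"
| IfF:    "reg s x = 0 \<Longrightarrow> exec q s m s' \<Longrightarrow> exec (IfNZ x p q) s (1 + m) s'"
| WhileT: "reg s x \<noteq> 0 \<Longrightarrow> exec p s l s' \<Longrightarrow> exec (WhileNZ x p) s' m s'' \<Longrightarrow>
             exec (WhileNZ x p) s (1 + l + m) s''"
| WhileF: "reg s x = 0 \<Longrightarrow> exec (WhileNZ x p) s 1 s"

inductive_cases exec_cases: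
  "exec Skip s m s'" "exec (SetC x c) s m s'" "exec (Copy x y) s m s'"
  "exec (Add x y z) s m s'" "exec (Sub x y z) s m s'" "exec (Load x a y) s m s'"
  "exec (Store a x y) s m s'" "exec (Output x) s m s'" "exec (Seq p q) s m s'"
  "exec (IfNZ x p q) s m s'" "exec (WhileNZ x p) s m s'"

lemma exec_deterministic:
  "exec p s m s' \<Longrightarrow> exec p s m2 s2 \<Longrightarrow> m2 = m \<and> s2 = s'"
proof (induction arbitrary: m2 s2 rule: exec.induct)
  case (Skip s) then show ?case by (elim exec_cases(1)) simp
next
  case (SetC x c s) then show ?case by (elim exec_cases(2)) simp
next
  case (Copy x y s) then show ?case by (elim exec_cases(3)) simp
next
  case (Add x y z s) then show ?case by (elim exec_cases(4)) simp
next
  case (Sub x y z s) then show ?case by (elim exec_cases(5)) simp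
next
  case (Load x a y s) then show ?case by (elim exec_cases(6)) simp
next
  case (Store a x y s) then show ?case by (elim exec_cases(7)) simp
next
  case (Output x s) then show ?case by (elim exec_cases(8)) simp
next
  case (Seq p s l s' q m s'')
  from Seq.prems show ?case by (rule exec_cases(9)) (metis Seq.IH)
next
  case (IfT s x p m s' q)
  from IfT.prems show ?case by (rule exec_cases(10)) (use IfT.hyps(1) in \<open>auto dest: IfT.IH\<close>)
next
  case (IfF s x q m s' p)
  from IfF.prems show ?case by (rule exec_cases(10)) (use IfF.hyps(1) in \<open>auto dest: IfF.IH\<close>)
next
  case (WhileT s x p l s' m s'')
  from WhileT.prems show ?case by (rule exec_cases(11)) (use WhileT.hyps(1) in \<open>auto dest!: WhileT.IH\<close>)
next
  case (WhileF s x p)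
  from WhileF.prems show ?case by (rule exec_cases(11)) (use WhileF.hyps in simp_all)
qed

definition init :: "nat list \<Rightarrow> state" where
  "init xs = \<lparr>reg = (\<lambda>i. if i < length xs then xs ! i else 0), mem = (\<lambda>_ _. 0), out = []\<rparr>"

definition computes_within :: "prog \<Rightarrow> nat list \<Rightarrow> nat list \<Rightarrow> real \<Rightarrow> bool" where
  "computes_within p xs ys T \<longleftrightarrow> (\<exists>m s. exec p (init xs) m s \<and> out s = ys \<and> real m \<le> T)"

text \<open>
  A constructed family of functions on \<open>[N] = {1..N}\<close> is a list, whose length is the size of the
  family (repetitions are counted). On the output tape each function is written as \<open>N\<close> followed
  by its table of values; the leading \<open>N\<close> keeps the encoding injective for \<open>N = 0\<close>.
\<close>

definition encode_family :: "nat \<Rightarrow> (nat \<Rightarrow> nat) list \<Rightarrow> nat list" where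
  "encode_family N hs = concat (map (\<lambda>h. N # map h [1..<Suc N]) hs)"

definition minimal_separating :: "nat \<Rightarrow> nat \<Rightarrow> nat \<Rightarrow> (nat \<Rightarrow> nat) set \<Rightarrow> bool" where
  "minimal_separating t k N H \<longleftrightarrow>
     H \<subseteq> {1..N} \<rightarrow>\<^sub>E {1..t + 1} \<and>
     (\<forall>C D. C \<subseteq> {1..N} \<and> D \<subseteq> {1..N} \<and> C \<inter> D = {} \<and> card C = t \<and> int (card D) \<le> int k - int t
        \<longrightarrow> (\<exists>h\<in>H. h ` C = {1..t} \<and> h ` D \<subseteq> {t + 1}))"

definition r_sets :: "nat \<Rightarrow> nat \<Rightarrow> (nat \<Rightarrow> nat) set" where
  "r_sets n r = {1..n} \<rightarrow>\<^sub>E {0..r}"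

definition msize :: "nat \<Rightarrow> (nat \<Rightarrow> nat) \<Rightarrow> nat" where
  "msize n A = (\<Sum>i\<in>{1..n}. A i)"

definition rk_sets :: "nat \<Rightarrow> nat \<Rightarrow> nat \<Rightarrow> (nat \<Rightarrow> nat) set" where
  "rk_sets n r k = {A \<in> r_sets n r. msize n A \<le> k}"

definition mle :: "nat \<Rightarrow> (nat \<Rightarrow> nat) \<Rightarrow> (nat \<Rightarrow> nat) \<Rightarrow> bool" where
  "mle n A B \<longleftrightarrow> (\<forall>i\<in>{1..n}. A i \<le> B i)"

definition mcompl :: "nat \<Rightarrow> nat \<Rightarrow> (nat \<Rightarrow> nat) \<Rightarrow> nat \<Rightarrow> nat" where
  "mcompl n r A = (\<lambda>i\<in>{1..n}. r - A i)"

definition msum :: "nat \<Rightarrow> (nat \<Rightarrow> nat) \<Rightarrow> (nat \<Rightarrow> nat) \<Rightarrow> nat \<Rightarrow> nat" where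
  "msum n A B = (\<lambda>i\<in>{1..n}. A i + B i)"

definition compatible :: "nat \<Rightarrow> nat \<Rightarrow> nat \<Rightarrow> (nat \<Rightarrow> nat) \<Rightarrow> (nat \<Rightarrow> nat) \<Rightarrow> bool" where
  "compatible n r k A B \<longleftrightarrow>
     A \<in> rk_sets n r k \<and> B \<in> rk_sets n r k \<and>
     msum n A B \<in> rk_sets n r k \<and> msize n (msum n A B) = k"

definition separator :: "nat \<Rightarrow> nat \<Rightarrow> nat \<Rightarrow> (nat \<Rightarrow> nat) set \<Rightarrow> bool" where
  "separator n r k F \<longleftrightarrow>
     F \<subseteq> r_sets n r \<and>
     (\<forall>A B. compatible n r k A B \<longrightarrow> (\<exists>X\<in>F. mle n A X \<and> mle n X (mcompl n r B)))"

end

theory Submission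
  imports Defs
begin

text \<open>
  If \<open>A\<close> and \<open>B\<close> are compatible, at most \<open>2 k / (r + 1) \<le> t\<close> elements are heavy, that is, have
  \<open>A i > r / 2\<close> or \<open>B i > r / 2\<close>; at every other element the value \<open>r div 2\<close> lies between \<open>A i\<close> and
  \<open>r - B i\<close>. Choose \<open>C\<close> of size \<open>t\<close> between the heavy elements and the support of \<open>A + B\<close> (or around
  the support, if that is smaller than \<open>t\<close>), and let \<open>D\<close> be the rest of the support. Some \<open>h\<close> of the
  family is injective on \<open>C\<close> and sends \<open>D\<close> to \<open>t + 1\<close>. So it suffices to take, for all \<open>h\<close> and all
  \<open>x < (r + 1) ^ t\<close>, the multiset that gives colour \<open>j \<le> t\<close> the \<open>j\<close>-th base \<open>r + 1\<close> digit of \<open>x\<close> and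
  colour \<open>t + 1\<close> the value \<open>r div 2\<close>.

  The machine runs \<open>P\<close> with its output redirected to a memory and then enumerates the pairs \<open>(h, x)\<close>,
  incrementing \<open>x\<close> as an odometer of \<open>t\<close> digits. Embedding \<open>P\<close> costs only a factor 2, and the
  running time of \<open>P\<close> bounds the length \<open>|H| (N + 1)\<close> of its output, so that all constants are
  independent of \<open>P\<close> and are absorbed by \<open>k ^ 6\<close>, since \<open>k \<ge> 2\<close>.
\<close>

section \<open>The combinatorial construction\<close>

text \<open>Colours are numbered from 1 and digits from 0, hence the exponent \<open>j - 1\<close>.
  The value 0 is not a colour.\<close>

definition cell :: "nat \<Rightarrow> nat \<Rightarrow> nat \<Rightarrow> nat \<Rightarrow> nat" where
  "cell r t x j = (if j \<le> t then x div (r + 1) ^ (j - 1) mod (r + 1) else r div 2)"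

definition coloured :: "nat \<Rightarrow> nat \<Rightarrow> nat \<Rightarrow> (nat \<Rightarrow> nat) \<Rightarrow> nat \<Rightarrow> nat \<Rightarrow> nat" where
  "coloured n r t h x = (\<lambda>i\<in>{1..n}. cell r t x (h i))"

definition coloured_family :: "nat \<Rightarrow> nat \<Rightarrow> nat \<Rightarrow> (nat \<Rightarrow> nat) list \<Rightarrow> (nat \<Rightarrow> nat) list" where
  "coloured_family n r t hs = concat (map (\<lambda>h. map (coloured n r t h) [0..<(r + 1) ^ t]) hs)"

lemma length_coloured_family: "length (coloured_family n r t hs) = length hs * (r + 1) ^ t"
  by (induction hs) (auto simp: coloured_family_def)

lemma set_coloured_family:
  "set (coloured_family n r t hs) = (\<Union>h\<in>set hs. coloured n r t h ` {..<(r + 1) ^ t})"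
  by (simp add: coloured_family_def atLeast0LessThan)

lemma coloured_family_snoc:
  "coloured_family n r t (hs @ [h]) =
     coloured_family n r t hs @ map (coloured n r t h) [0..<(r + 1) ^ t]"
  by (simp add: coloured_family_def)

section \<open>Base \<open>r + 1\<close> digits and the odometer increment\<close>

lemma digits_exist:
  fixes v :: "nat \<Rightarrow> nat"
  assumes "\<And>j. j < t \<Longrightarrow> v j < b"
  shows "\<exists>x < b ^ t. \<forall>j < t. x div b ^ j mod b = v j"
  using assms
proof (induction t arbitrary: v)
  case (Suc t)
  from Suc.IH[of "\<lambda>j. v (Suc j)"] Suc.prems obtain x where x: "x < b ^ t"
    and d: "\<And>j. j < t \<Longrightarrow> x div b ^ j mod b = v (Suc j)" by auto
  have v0: "v 0 < b" using Suc.prems[of 0] by simp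
  \<comment> \<open>Horner's rule: \<open>x\<close> has the shifted digits \<open>v (Suc j)\<close>,
    and \<open>v 0\<close> becomes the new lowest digit.\<close>
  have "v 0 + b * x < b * Suc x" using v0 by simp
  also have "\<dots> \<le> b * b ^ t" using x by (intro mult_left_mono) auto
  finally have lt: "v 0 + b * x < b ^ Suc t" by simp
  have "(v 0 + b * x) div b ^ j mod b = v j" if "j < Suc t" for j
  proof (cases j)
    case 0
    then show ?thesis using v0 by simp
  next
    case (Suc i)
    have "(v 0 + b * x) div b ^ Suc i = (v 0 + b * x) div b div b ^ i"
      by (simp add: div_mult2_eq)
    also have "(v 0 + b * x) div b = x" using v0 by simp
    finally show ?thesis using d[of i] Suc that by simp
  qed
  with lt show ?case by blast
qed simp

lemma cell_le: "cell r t x j \<le> r"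
  by (simp add: cell_def mod_Suc_le_divisor)

text \<open>The quotient of \<open>x\<close> by \<open>(r + 1) ^ j\<close> grows under the increment
  exactly if this power divides \<open>Suc x\<close>. So divisibility is the carry into digit
  \<open>j\<close>; the first claim gives the new digit, the second the carry out of it.\<close>

lemma cell_Suc:
  assumes "j < t"
  shows "cell r t (Suc x) (Suc j) =
           (let y = cell r t x (Suc j) + (if (r + 1) ^ j dvd Suc x then 1 else 0)
            in if r < y then 0 else y)"
    and "(r + 1) ^ Suc j dvd Suc x \<longleftrightarrow>
           r < cell r t x (Suc j) + (if (r + 1) ^ j dvd Suc x then 1 else 0)"
proof -
  let ?b = "r + 1"
  have div: "Suc x div ?b ^ j = x div ?b ^ j + (if ?b ^ j dvd Suc x then 1 else 0)"
    by (simp add: div_Suc dvd_eq_mod_eq_0)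
  have le: "x div ?b ^ j mod ?b \<le> r" by (simp add: mod_Suc_le_divisor)
  have c: "cell r t y (Suc j) = y div ?b ^ j mod ?b" for y
    using assms by (simp add: cell_def)
  have md: "Suc z mod ?b = (if r < Suc (z mod ?b) then 0 else Suc (z mod ?b))" for z
  proof -
    consider "z mod ?b = r" | "z mod ?b < r"
      using mod_Suc_le_divisor[of z r] by (auto simp: le_less)
    then show ?thesis by cases (auto simp: mod_Suc)
  qed
  show "cell r t (Suc x) (Suc j) =
           (let y = cell r t x (Suc j) + (if ?b ^ j dvd Suc x then 1 else 0)
            in if r < y then 0 else y)"
    using leD[OF le] md[of "x div ?b ^ j"] unfolding c div by (auto simp: Let_def)
  show "?b ^ Suc j dvd Suc x \<longleftrightarrow>
           r < cell r t x (Suc j) + (if ?b ^ j dvd Suc x then 1 else 0)"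
  proof (cases "?b ^ j dvd Suc x")
    case True
    then have "Suc x = ?b ^ j * (Suc x div ?b ^ j)" by simp
    then have "?b ^ Suc j dvd Suc x \<longleftrightarrow> ?b ^ j * ?b dvd ?b ^ j * (Suc x div ?b ^ j)"
      by (simp only: power_Suc2)
    also have "\<dots> \<longleftrightarrow> ?b dvd Suc x div ?b ^ j" by (rule dvd_times_left_cancel_iff) simp
    also have "\<dots> \<longleftrightarrow> r < Suc (x div ?b ^ j mod ?b)"
      using True md[of "x div ?b ^ j"] unfolding div by (simp add: dvd_eq_mod_eq_0)
    finally show ?thesis using True c by simp
  next
    case False
    then have "\<not> ?b ^ Suc j dvd Suc x" using dvd_mult_right by (metis power_Suc)
    then show ?thesis using False c leD[OF le] by simp
  qed
qed

section \<open>Separation by colouring the heavy elements\<close>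

lemma exists_heavy_superset:
  assumes "compatible n r k A B" "1 < r" "t = 2 * k div r" "t \<le> N" "n \<le> N"
  obtains C D where "C \<subseteq> {1..N}" "D \<subseteq> {1..N}" "C \<inter> D = {}" "card C = t"
    "int (card D) \<le> int k - int t"
    "\<And>i. i \<in> {1..n} - C \<Longrightarrow> A i \<le> r div 2 \<and> B i \<le> r div 2"
    "\<And>i. i \<in> {1..n} - (C \<union> D) \<Longrightarrow> A i = 0 \<and> B i = 0"
proof -
  define S where "S = {i \<in> {1..n}. 0 < A i + B i}"
  define W where "W = {i \<in> {1..n}. r < 2 * A i \<or> r < 2 * B i}"
  have sub: "W \<subseteq> S" "S \<subseteq> {1..n}" by (auto simp: W_def S_def)
  then have fin: "finite S" "finite W" by (auto intro: finite_subset)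
  have sum: "(\<Sum>i\<in>{1..n}. A i + B i) = k"
    using assms(1) by (simp add: compatible_def msize_def msum_def)
  have "card S = (\<Sum>i\<in>S. 1)" by simp
  also have "\<dots> \<le> (\<Sum>i\<in>S. A i + B i)" by (intro sum_mono) (auto simp: S_def)
  also have "\<dots> \<le> k" using sub sum sum_mono2[of "{1..n}" S "\<lambda>i. A i + B i"] by simp
  finally have cS: "card S \<le> k" .
  \<comment> \<open>Every heavy element has \<open>r \<le> 2 * (A i + B i)\<close>, while all the
    \<open>A i + B i\<close> sum to \<open>k\<close>. This double count is the origin of
    \<open>t = 2 * k div r\<close>.\<close>
  have "card W * r = (\<Sum>i\<in>W. r)" by simp
  also have "\<dots> \<le> (\<Sum>i\<in>W. 2 * (A i + B i))" by (intro sum_mono) (auto simp: W_def)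
  also have "\<dots> = 2 * (\<Sum>i\<in>W. A i + B i)" by (rule sum_distrib_left[symmetric])
  also have "\<dots> \<le> 2 * k" using sub sum sum_mono2[of "{1..n}" W "\<lambda>i. A i + B i"] by simp
  finally have cW: "card W \<le> t" using assms(2,3) by (simp add: less_eq_div_iff_mult_less_eq)
  \<comment> \<open>If the support fits into \<open>C\<close>, then \<open>D\<close> is empty and
    its size bound reads \<open>0 \<le> k - t\<close>.\<close>
  have tk: "t \<le> k"
  proof -
    have "2 * k div r \<le> 2 * k div 2" using assms(2) by (intro div_le_mono2) auto
    then show ?thesis using assms(3) by simp
  qed
  have light: "A i \<le> r div 2 \<and> B i \<le> r div 2" if "i \<in> {1..n} - W" for i
    using that by (auto simp: W_def)
  have zero: "A i = 0 \<and> B i = 0" if "i \<in> {1..n} - S" for i using that by (auto simp: S_def)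
  \<comment> \<open>A small support is padded to size \<open>t\<close> inside \<open>{1..N}\<close>,
    possibly beyond \<open>{1..n}\<close>; \<open>t \<le> N\<close> leaves room for this. For a
    large support, \<open>D\<close> has \<open>card S - t\<close> elements.\<close>
  have "\<exists>C. W \<subseteq> C \<and> C \<subseteq> {1..N} \<and> card C = t \<and> int (card (S - C)) \<le> int k - int t"
  proof (cases "card S \<le> t")
    case True
    have "S \<subseteq> {1..N}" using sub assms(5) by auto
    then obtain C where "S \<subseteq> C" "C \<subseteq> {1..N}" "card C = t"
      using exists_subset_between[of S t "{1..N}"] True assms(4) by auto
    moreover from this have "card (S - C) = 0" by (metis Diff_eq_empty_iff card.empty)
    ultimately show ?thesis using sub tk by (intro exI[of _ C]) auto
  next
    case False
    then obtain C where C: "W \<subseteq> C" "C \<subseteq> S" "card C = t"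
      using exists_subset_between[of W t S] cW sub fin by auto
    then have "card (S - C) = card S - t" using fin by (simp add: card_Diff_subset finite_subset)
    then have "int (card (S - C)) \<le> int k - int t" using False cS by linarith
    moreover have "C \<subseteq> {1..N}" using C sub assms(5) by fastforce
    ultimately show ?thesis using C by blast
  qed
  then obtain C where "W \<subseteq> C" "C \<subseteq> {1..N}" "card C = t" "int (card (S - C)) \<le> int k - int t" by blast
  moreover have "S - C \<subseteq> {1..N}" using sub assms(5) by fastforce
  ultimately show thesis using light zero by (intro that[of C "S - C"]) auto
qed

lemma separator_coloured_family:
  assumes "1 < r" and t: "t = 2 * k div r" and N: "N = max n t"
    and sep: "minimal_separating t k N (set hs)"
  shows "separator n r k (set (coloured_family n r t hs))"
  unfolding separator_def
proof (intro conjI allI impI)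
  show "set (coloured_family n r t hs) \<subseteq> r_sets n r"
    by (auto simp: coloured_family_def coloured_def r_sets_def cell_le)
next
  fix A B assume AB: "compatible n r k A B"
  have "t \<le> N" "n \<le> N" using N by auto
  from exists_heavy_superset[OF AB assms(1,2) this] obtain C D where
    CD: "C \<subseteq> {1..N}" "D \<subseteq> {1..N}" "C \<inter> D = {}" "card C = t" "int (card D) \<le> int k - int t"
    and light: "\<And>i. i \<in> {1..n} - C \<Longrightarrow> A i \<le> r div 2 \<and> B i \<le> r div 2"
    and zero: "\<And>i. i \<in> {1..n} - (C \<union> D) \<Longrightarrow> A i = 0 \<and> B i = 0"
    by blast
  have "\<exists>h\<in>set hs. h ` C = {1..t} \<and> h ` D \<subseteq> {t + 1}"
    using sep CD unfolding minimal_separating_def by simp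
  then obtain h where h: "h \<in> set hs" "h ` C = {1..t}" "h ` D \<subseteq> {t + 1}" by blast
  have "finite C" using CD(1) finite_subset by blast
  then have inj: "inj_on h C" using h(2) CD(4) by (simp add: eq_card_imp_inj_on)
  define g where "g = the_inv_into C h"
  have AB_le: "A i + B i \<le> r" if "i \<in> {1..n}" for i
    using AB that by (auto simp: compatible_def rk_sets_def r_sets_def msum_def PiE_iff)
  \<comment> \<open>Digit \<open>j\<close> is the value of \<open>A\<close> at the element of
    \<open>C\<close> with colour \<open>Suc j\<close>. Elements of \<open>C\<close> outside
    \<open>{1..n}\<close>, possible if \<open>n < t\<close>, get digit 0.\<close>
  have "\<exists>x < (r + 1) ^ t. \<forall>j < t. x div (r + 1) ^ j mod (r + 1) =
          (if g (Suc j) \<in> {1..n} then A (g (Suc j)) else 0)"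
    using AB_le by (intro digits_exist) (auto simp: less_Suc_eq_le dest: add_leD1)
  then obtain x where x: "x < (r + 1) ^ t"
    "\<And>j. j < t \<Longrightarrow> x div (r + 1) ^ j mod (r + 1) = (if g (Suc j) \<in> {1..n} then A (g (Suc j)) else 0)"
    by blast
  let ?X = "coloured n r t h x"
  have C_eq: "cell r t x (h i) = A i" if "i \<in> C" "i \<in> {1..n}" for i
  proof -
    have "h i \<in> {1..t}" using h(2) that by auto
    then have "h i - 1 < t" "Suc (h i - 1) = h i" by auto
    moreover have "g (h i) = i" using inj that by (simp add: g_def the_inv_into_f_f)
    ultimately show ?thesis using x(2)[of "h i - 1"] that by (simp add: cell_def del: One_nat_def)
  qed
  have D_eq: "cell r t x (h i) = r div 2" if "i \<in> D" for i
    using h(3) that by (auto simp: cell_def)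
  have X: "A i \<le> cell r t x (h i) \<and> cell r t x (h i) \<le> r - B i" if i: "i \<in> {1..n}" for i
  proof -
    consider "i \<in> C" | "i \<in> D" "i \<notin> C" | "i \<notin> C \<union> D" by blast
    then show ?thesis
    proof cases
      case 1
      then show ?thesis using C_eq[OF 1 i] AB_le[OF i] by simp
    next
      case 2
      then have "A i \<le> r div 2" "B i \<le> r div 2" using light i by auto
      then show ?thesis using D_eq 2 by auto
    next
      case 3
      \<comment> \<open>Outside the support nothing is known about the colour, but every value up to
        \<open>r\<close> lies between \<open>A i = 0\<close> and \<open>r - B i = r\<close>.\<close>
      then show ?thesis using zero i by (simp add: cell_le)
    qed
  qed
  have "?X \<in> set (coloured_family n r t hs)" 
    unfolding set_coloured_family by (intro UN_I[OF h(1)] imageI) (use x(1) in simp)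
  then show "\<exists>X\<in>set (coloured_family n r t hs). mle n A X \<and> mle n X (mcompl n r B)"
    using X by (intro bexI[of _ ?X]) (auto simp: mle_def mcompl_def coloured_def)
qed

section \<open>Reasoning about programs\<close>

text \<open>The postcondition of \<open>wp\<close> receives the part of the step budget that is left.\<close>

definition wp :: "prog \<Rightarrow> (state \<Rightarrow> nat \<Rightarrow> bool) \<Rightarrow> state \<Rightarrow> nat \<Rightarrow> bool" where
  "wp p Q s T \<longleftrightarrow> (\<exists>m s'. exec p s m s' \<and> m \<le> T \<and> Q s' (T - m))"

lemma wp_basic [simp]:
  "wp Skip Q s T \<longleftrightarrow> 1 \<le> T \<and> Q s (T - 1)"
  "wp (SetC x c) Q s T \<longleftrightarrow> 1 \<le> T \<and> Q (set_reg x c s) (T - 1)"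
  "wp (Copy x y) Q s T \<longleftrightarrow> 1 \<le> T \<and> Q (set_reg x (reg s y) s) (T - 1)"
  "wp (Add x y z) Q s T \<longleftrightarrow> 1 \<le> T \<and> Q (set_reg x (reg s y + reg s z) s) (T - 1)"
  "wp (Sub x y z) Q s T \<longleftrightarrow> 1 \<le> T \<and> Q (set_reg x (reg s y - reg s z) s) (T - 1)"
  "wp (Load x a y) Q s T \<longleftrightarrow> 1 \<le> T \<and> Q (set_reg x (mem s a (reg s y)) s) (T - 1)"
  "wp (Store a x y) Q s T \<longleftrightarrow> 1 \<le> T \<and> Q (set_mem a (reg s x) (reg s y) s) (T - 1)"
  "wp (Output x) Q s T \<longleftrightarrow> 1 \<le> T \<and> Q (s\<lparr>out := out s @ [reg s x]\<rparr>) (T - 1)"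
  unfolding wp_def by (auto elim!: exec_cases intro: exec.intros[unfolded One_nat_def])

lemma wp_Seq [simp]: "wp (Seq p q) Q s T \<longleftrightarrow> wp p (wp q Q) s T"
proof
  assume "wp (Seq p q) Q s T"
  then obtain m s'' where *: "exec (Seq p q) s m s''" "m \<le> T" "Q s'' (T - m)"
    unfolding wp_def by blast
  from *(1) obtain l l' s' where "exec p s l s'" "exec q s' l' s''" "m = l + l'"
    by (rule exec_cases(9)) blast
  moreover have "l' \<le> T - l" "T - l - l' = T - m" using *(2) \<open>m = l + l'\<close> by auto
  ultimately show "wp p (wp q Q) s T"
    unfolding wp_def using * by (metis add_leD1)
next
  assume "wp p (wp q Q) s T"
  then obtain l s' l' s'' where "exec p s l s'" "l \<le> T" "exec q s' l' s''" "l' \<le> T - l"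
    "Q s'' (T - l - l')"
    unfolding wp_def by blast
  then show "wp (Seq p q) Q s T"
    unfolding wp_def by (intro exI[of _ "l + l'"] exI[of _ s'']) (auto intro: exec.Seq)
qed

lemma wp_IfNZ [simp]:
  "wp (IfNZ x p q) Q s T \<longleftrightarrow> 1 \<le> T \<and> (if reg s x \<noteq> 0 then wp p Q s (T - 1) else wp q Q s (T - 1))"
proof (cases "reg s x = 0")
  case True
  then have "exec (IfNZ x p q) s m s' \<longleftrightarrow> (\<exists>l. m = Suc l \<and> exec q s l s')" for m s'
    by (auto elim: exec_cases(10) intro: exec.IfF[of s x q _ s' p, simplified])
  then show ?thesis using True unfolding wp_def by (cases T) (simp, simp, metis Suc_le_mono diff_Suc_Suc)
next
  case False
  then have "exec (IfNZ x p q) s m s' \<longleftrightarrow> (\<exists>l. m = Suc l \<and> exec p s l s')" for m s'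
    by (auto elim: exec_cases(10) intro: exec.IfT[of s x p _ s' q, simplified])
  then show ?thesis using False unfolding wp_def by (cases T) (simp, simp, metis Suc_le_mono diff_Suc_Suc)
qed

text \<open>Specifications are proved for one fixed budget \<open>T'\<close> and reused under a
  larger one. Of the remaining budget \<open>R\<close> only the lower bound \<open>T - T'\<close> is
  known.\<close>

lemma wp_conseq:
  assumes "wp p (\<lambda>s' _. J s') s T'" "T' \<le> T"
    "\<And>s' R. J s' \<Longrightarrow> T - T' \<le> R \<Longrightarrow> Q s' R"
  shows "wp p Q s T"
  using assms unfolding wp_def by (metis diff_le_mono2 le_trans)

lemma wp_While:
  assumes "I 0 s"
    and step: "\<And>i s. i < n \<Longrightarrow> I i s \<Longrightarrow> reg s x \<noteq> 0 \<and> wp p (\<lambda>s' _. I (Suc i) s') s B"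
    and stop: "\<And>s. I n s \<Longrightarrow> reg s x = 0"
    and T: "n * Suc B + 1 \<le> T"
  shows "wp (WhileNZ x p) (\<lambda>s' _. I n s') s T"
proof -
  have "\<exists>m s'. exec (WhileNZ x p) s m s' \<and> m \<le> (n - i) * Suc B + 1 \<and> I n s'"
    if "i \<le> n" "I i s" for i s
    using that
  proof (induction "n - i" arbitrary: i s)
    case 0
    then show ?case using stop exec.WhileF[of s x p] by (intro exI[of _ 1]) auto
  next
    case (Suc d)
    then have "i < n" by simp
    from step[OF this Suc.prems(2)] obtain l s1 where
      1: "reg s x \<noteq> 0" "exec p s l s1" "l \<le> B" "I (Suc i) s1"
      unfolding wp_def by blast
    have "d = n - Suc i" "Suc i \<le> n" using Suc.hyps(2) \<open>i < n\<close> by auto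
    from Suc.hyps(1)[OF this 1(4)] obtain m s' where
      2: "exec (WhileNZ x p) s1 m s'" "m \<le> (n - Suc i) * Suc B + 1" "I n s'" by blast
    have "n - i = Suc (n - Suc i)" using \<open>i < n\<close> by simp
    then have "1 + l + m \<le> (n - i) * Suc B + 1" using 1(3) 2(2) by simp
    then show ?case using exec.WhileT[OF 1(1,2) 2(1)] 2(3) by blast
  qed
  from this[of 0 s] assms(1) obtain m s' where
    "exec (WhileNZ x p) s m s'" "m \<le> n * Suc B + 1" "I n s'" by auto
  with T show ?thesis unfolding wp_def by (meson le_trans)
qed

text \<open>The clause for one-element lists avoids a closing \<open>Skip\<close>, which would cost
  a step.\<close>

fun seq :: "prog list \<Rightarrow> prog" where
  "seq [] = Skip"
| "seq [p] = p"
| "seq (p # q # ps) = Seq p (seq (q # ps))"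

lemma set_reg_simps [simp]:
  "reg (set_reg x v s) = (reg s)(x := v)" "mem (set_reg x v s) = mem s" "out (set_reg x v s) = out s"
  by (simp_all add: set_reg_def)

lemma set_mem_simps [simp]:
  "reg (set_mem a i v s) = reg s" "mem (set_mem a i v s) = (mem s)(a := (mem s a)(i := v))"
  "out (set_mem a i v s) = out s"
  by (simp_all add: set_mem_def)

lemma exec_time_pos: "exec p s m s' \<Longrightarrow> 1 \<le> m"
  by (induction rule: exec.induct) auto

text \<open>Each step writes at most one number. Hence the running time of \<open>P\<close> bounds
  the length of the table that is traversed later.\<close>

lemma length_out_le: "exec p s m s' \<Longrightarrow> length (out s') \<le> length (out s) + m"
  by (induction rule: exec.induct) auto

section \<open>Redirecting the output to a memory\<close>

text \<open>A common strict bound on register and memory indices, so that one number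
  \<open>b\<close> names both a fresh register and a fresh memory.\<close>

primrec width :: "prog \<Rightarrow> nat" where
  "width Skip = 0"
| "width (SetC x c) = Suc x"
| "width (Copy x y) = Suc (max x y)"
| "width (Add x y z) = Suc (max x (max y z))"
| "width (Sub x y z) = Suc (max x (max y z))"
| "width (Load x a y) = Suc (max x (max a y))"
| "width (Store a x y) = Suc (max a (max x y))"
| "width (Output x) = Suc x"
| "width (Seq p q) = max (width p) (width q)"
| "width (IfNZ x p q) = max (Suc x) (max (width p) (width q))"
| "width (WhileNZ x p) = max (Suc x) (width p)"

text \<open>Register \<open>b\<close> counts the outputs, and register \<open>b + 14\<close> is expected to hold \<open>1\<close>.\<close>

primrec redirect :: "nat \<Rightarrow> prog \<Rightarrow> prog" where
  "redirect b Skip = Skip"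
| "redirect b (SetC x c) = SetC x c"
| "redirect b (Copy x y) = Copy x y"
| "redirect b (Add x y z) = Add x y z"
| "redirect b (Sub x y z) = Sub x y z"
| "redirect b (Load x a y) = Load x a y"
| "redirect b (Store a x y) = Store a x y"
| "redirect b (Output x) = Seq (Store b b x) (Add b b (b + 14))"
| "redirect b (Seq p q) = Seq (redirect b p) (redirect b q)"
| "redirect b (IfNZ x p q) = IfNZ x (redirect b p) (redirect b q)"
| "redirect b (WhileNZ x p) = WhileNZ x (redirect b p)"

text \<open>Here \<open>\<rho>\<close> is the state in which the embedded run starts. It acts as a
  frame: the run preserves everything above index \<open>b\<close> and the real output tape.\<close>

definition simulates :: "nat \<Rightarrow> state \<Rightarrow> state \<Rightarrow> state \<Rightarrow> bool" where
  "simulates b \<rho> s \<sigma> \<longleftrightarrow>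
     (\<forall>x<b. reg \<sigma> x = reg s x) \<and> (\<forall>a<b. mem \<sigma> a = mem s a) \<and>
     reg \<sigma> b = length (out s) \<and> (\<forall>i<length (out s). mem \<sigma> b i = out s ! i) \<and>
     (\<forall>x>b. reg \<sigma> x = reg \<rho> x) \<and> (\<forall>a>b. mem \<sigma> a = mem \<rho> a) \<and> out \<sigma> = out \<rho>"

text \<open>Only \<open>Output\<close> is replaced, by a store and an increment; this is the factor
  2. All other instructions act below \<open>b\<close> and correspond one to one.\<close>

lemma redirect_simulates:
  assumes "exec p s m s'" "width p \<le> b" "simulates b \<rho> s \<sigma>" "reg \<rho> (b + 14) = 1"
  shows "\<exists>m' \<sigma>'. exec (redirect b p) \<sigma> m' \<sigma>' \<and> m' \<le> 2 * m \<and> simulates b \<rho> s' \<sigma>'"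
  using assms
proof (induction arbitrary: \<sigma> rule: exec.induct)
  case (Skip s)
  then show ?case by (auto intro!: exI exec.Skip)
next
  case (SetC x c s)
  then have "simulates b \<rho> (set_reg x c s) (set_reg x c \<sigma>)" by (auto simp: simulates_def)
  then show ?case using exec.SetC by (metis redirect.simps(2) one_le_numeral mult_1_right)
next
  case (Copy x y s)
  then have "simulates b \<rho> (set_reg x (reg s y) s) (set_reg x (reg \<sigma> y) \<sigma>)"
    by (auto simp: simulates_def)
  then show ?case using exec.Copy by (metis redirect.simps(3) one_le_numeral mult_1_right)
next
  case (Add x y z s)
  then have "simulates b \<rho> (set_reg x (reg s y + reg s z) s) (set_reg x (reg \<sigma> y + reg \<sigma> z) \<sigma>)"
    by (auto simp: simulates_def)
  then show ?case using exec.Add by (metis redirect.simps(4) one_le_numeral mult_1_right)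
next
  case (Sub x y z s)
  then have "simulates b \<rho> (set_reg x (reg s y - reg s z) s) (set_reg x (reg \<sigma> y - reg \<sigma> z) \<sigma>)"
    by (auto simp: simulates_def)
  then show ?case using exec.Sub by (metis redirect.simps(5) one_le_numeral mult_1_right)
next
  case (Load x a y s)
  then have "simulates b \<rho> (set_reg x (mem s a (reg s y)) s) (set_reg x (mem \<sigma> a (reg \<sigma> y)) \<sigma>)"
    by (auto simp: simulates_def)
  then show ?case using exec.Load by (metis redirect.simps(6) one_le_numeral mult_1_right)
next
  case (Store a x y s)
  then have "simulates b \<rho> (set_mem a (reg s x) (reg s y) s) (set_mem a (reg \<sigma> x) (reg \<sigma> y) \<sigma>)"
    by (auto simp: simulates_def)
  then show ?case using exec.Store by (metis redirect.simps(7) one_le_numeral mult_1_right)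
next
  case (Output x s)
  let ?\<sigma>1 = "set_mem b (reg \<sigma> b) (reg \<sigma> x) \<sigma>"
  let ?\<sigma>2 = "set_reg b (reg ?\<sigma>1 b + reg ?\<sigma>1 (b + 14)) ?\<sigma>1"
  have "simulates b \<rho> (s\<lparr>out := out s @ [reg s x]\<rparr>) ?\<sigma>2"
    using Output by (auto simp: simulates_def nth_append less_Suc_eq)
  moreover have "exec (redirect b (Output x)) \<sigma> (1 + 1) ?\<sigma>2"
    unfolding redirect.simps by (rule exec.Seq[OF exec.Store exec.Add])
  ultimately show ?case by (metis one_add_one order_refl mult_1_right)
next
  case (Seq p s l s' q m s'')
  from Seq.IH(1)[of \<sigma>] Seq.prems obtain l' \<sigma>' where
    1: "exec (redirect b p) \<sigma> l' \<sigma>'" "l' \<le> 2 * l" "simulates b \<rho> s' \<sigma>'" by auto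
  from Seq.IH(2)[of \<sigma>'] Seq.prems 1(3) obtain m' \<sigma>'' where
    2: "exec (redirect b q) \<sigma>' m' \<sigma>''" "m' \<le> 2 * m" "simulates b \<rho> s'' \<sigma>''" by auto
  have "l' + m' \<le> 2 * (l + m)" using 1(2) 2(2) by simp
  with exec.Seq[OF 1(1) 2(1)] 2(3) show ?case by auto
next
  case (IfT s x p m s' q)
  from IfT.IH[of \<sigma>] IfT.prems obtain m' \<sigma>' where
    1: "exec (redirect b p) \<sigma> m' \<sigma>'" "m' \<le> 2 * m" "simulates b \<rho> s' \<sigma>'" by auto
  have "reg \<sigma> x \<noteq> 0" using IfT.prems IfT.hyps(1) by (auto simp: simulates_def)
  from exec.IfT[OF this 1(1)] 1(2,3) show ?case
    by (intro exI[of _ "1 + m'"] exI[of _ \<sigma>']) auto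
next
  case (IfF s x q m s' p)
  from IfF.IH[of \<sigma>] IfF.prems obtain m' \<sigma>' where
    1: "exec (redirect b q) \<sigma> m' \<sigma>'" "m' \<le> 2 * m" "simulates b \<rho> s' \<sigma>'" by auto
  have "reg \<sigma> x = 0" using IfF.prems IfF.hyps(1) by (auto simp: simulates_def)
  from exec.IfF[OF this 1(1)] 1(2,3) show ?case
    by (intro exI[of _ "1 + m'"] exI[of _ \<sigma>']) auto
next
  case (WhileT s x p l s' m s'')
  from WhileT.IH(1)[of \<sigma>] WhileT.prems obtain l' \<sigma>' where
    1: "exec (redirect b p) \<sigma> l' \<sigma>'" "l' \<le> 2 * l" "simulates b \<rho> s' \<sigma>'" by auto
  from WhileT.IH(2)[of \<sigma>'] WhileT.prems 1(3) obtain m' \<sigma>'' where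
    2: "exec (WhileNZ x (redirect b p)) \<sigma>' m' \<sigma>''" "m' \<le> 2 * m" "simulates b \<rho> s'' \<sigma>''" by auto
  have "reg \<sigma> x \<noteq> 0" using WhileT.prems WhileT.hyps(1) by (auto simp: simulates_def)
  from exec.WhileT[OF this 1(1) 2(1)] 1(2) 2(2,3) show ?case
    by (intro exI[of _ "1 + l' + m'"] exI[of _ \<sigma>'']) auto
next
  case (WhileF s x p)
  have "reg \<sigma> x = 0" using WhileF by (auto simp: simulates_def)
  from exec.WhileF[OF this, of "redirect b p"] WhileF show ?case
    by (intro exI[of _ 1] exI[of _ \<sigma>]) auto
qed

section \<open>The program\<close>

text \<open>
  Register \<open>b\<close> holds the number of outputs of \<open>P\<close>, registers \<open>b + 3\<close> to \<open>b + 6\<close> the values of \<open>n\<close>,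
  \<open>r\<close>, \<open>t\<close>, \<open>N\<close>, register \<open>b + 7\<close> the position of the current function in memory \<open>b\<close>, register
  \<open>b + 8\<close> the length of the table from there on, register \<open>b + 9\<close> is zero once all \<open>x\<close> have been used,
  register \<open>b + 13\<close> is the carry of the odometer, and register \<open>b + 14\<close> the constant 1. Cell \<open>j\<close> of
  memory \<open>b + 14\<close> holds \<open>cell r t x j\<close> for the current \<open>x\<close>; the overflow at \<open>x = (r + 1) ^ t\<close> resets
  the digits to 0 for the next function.
\<close>

definition quotient_loop :: "nat \<Rightarrow> prog" where
  "quotient_loop b = WhileNZ (b + 10) (seq [Add (b + 5) (b + 5) (b + 14), Sub (b + 10) (b + 10) (b + 4)])"

definition halving_loop :: "nat \<Rightarrow> prog" where
  "halving_loop b = WhileNZ (b + 10) (seq [Add (b + 11) (b + 11) (b + 14), Sub (b + 10) (b + 10) (b + 14),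
       Sub (b + 10) (b + 10) (b + 14)])"

text \<open>Repeated truncated subtraction counts a quotient rounded up; starting from
  \<open>2 * k + 1 - r\<close> and from \<open>r - 1\<close> makes it yield
  \<open>2 * k div r\<close> and \<open>r div 2\<close>. The maximum of \<open>n\<close> and
  \<open>t\<close> is \<open>(n - t) + t\<close>. The final copies install the input of
  \<open>P\<close>.\<close>

definition prepare :: "nat \<Rightarrow> prog" where
  "prepare b = seq
    [Copy (b + 3) 0, Copy (b + 4) 1, SetC (b + 14) 1,
     Add (b + 10) 2 2, Add (b + 10) (b + 10) (b + 14), Sub (b + 10) (b + 10) (b + 4),
     quotient_loop b,
     Sub (b + 10) (b + 4) (b + 14),
     halving_loop b,
     Add (b + 10) (b + 5) (b + 14), Store (b + 14) (b + 10) (b + 11),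
     Sub (b + 6) (b + 3) (b + 5), Add (b + 6) (b + 6) (b + 5),
     Copy 0 (b + 4), Copy 1 2, Copy 2 (b + 6)]"

text \<open>The pointer \<open>b + 11\<close> advances before each read and so skips the leading
  \<open>N\<close> of the function. The second load translates a colour into its current
  value.\<close>

definition emit_values :: "nat \<Rightarrow> prog" where
  "emit_values b = WhileNZ (b + 10) (seq
    [Add (b + 11) (b + 11) (b + 14), Load (b + 12) b (b + 11), Load (b + 12) (b + 14) (b + 12),
     Output (b + 12), Sub (b + 10) (b + 10) (b + 14)])"

text \<open>Digit plus carry is at most \<open>r + 1\<close>, so its truncated difference with
  \<open>r\<close> is already the next carry, 0 or 1.\<close>

definition carry_body :: "nat \<Rightarrow> prog" where
  "carry_body b = seq
    [Add (b + 11) (b + 11) (b + 14), Load (b + 12) (b + 14) (b + 11), Add (b + 12) (b + 12) (b + 13),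
     Sub (b + 13) (b + 12) (b + 4), IfNZ (b + 13) (SetC (b + 12) 0) Skip,
     Store (b + 14) (b + 11) (b + 12), Sub (b + 10) (b + 10) (b + 14)]"

definition carry_loop :: "nat \<Rightarrow> prog" where
  "carry_loop b = WhileNZ (b + 10) (carry_body b)"

text \<open>The increment of \<open>x\<close> enters as a carry 1 into the lowest digit; a carry out
  of the highest one ends the enumeration.\<close>

definition colour_body :: "nat \<Rightarrow> prog" where
  "colour_body b = seq
    [Output (b + 3), Copy (b + 10) (b + 3), Copy (b + 11) (b + 7), emit_values b,
     Copy (b + 10) (b + 5), SetC (b + 11) 0, SetC (b + 13) 1, carry_loop b,
     Sub (b + 9) (b + 14) (b + 13)]"

definition colour_loop :: "nat \<Rightarrow> prog" where
  "colour_loop b = WhileNZ (b + 9) (colour_body b)"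

definition family_loop :: "nat \<Rightarrow> prog" where
  "family_loop b = WhileNZ (b + 8) (seq
    [SetC (b + 9) 1, colour_loop b, Add (b + 7) (b + 7) (b + 6), Add (b + 7) (b + 7) (b + 14),
     Sub (b + 8) b (b + 7)])"

section \<open>Correctness and step counts of the program parts\<close>

lemma reg_init:
  "reg (init [u, v, w]) x = (if x = 0 then u else if x = 1 then v else if x = 2 then w else 0)"
  by (auto simp: init_def nth_Cons' numeral_2_eq_2)

lemma init_simps [simp]: "mem (init xs) = (\<lambda>_ _. 0)" "out (init xs) = []"
  by (simp_all add: init_def)

text \<open>The budget consists of 14 elementary instructions and two loops of at most
  \<open>3 * k + 1\<close> and \<open>4 * k + 1\<close> steps.\<close>

lemma prepare_spec:
  assumes "3 \<le> b" "1 < r" "r \<le> k"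
  defines "t \<equiv> 2 * k div r"
  shows "wp (prepare b) (\<lambda>s _.
     (\<forall>x<b. reg s x = reg (init [r, k, max n t]) x) \<and>
     (\<forall>a. a \<noteq> b + 14 \<longrightarrow> mem s a = (\<lambda>_. 0)) \<and> mem s (b + 14) = (\<lambda>_. 0)(t + 1 := r div 2) \<and>
     out s = [] \<and> reg s b = 0 \<and> reg s (b + 14) = 1 \<and> reg s (b + 3) = n \<and> reg s (b + 4) = r \<and>
     reg s (b + 5) = t \<and> reg s (b + 6) = max n t \<and> reg s (b + 7) = 0) (init [n, r, k]) (7 * k + 16)"
proof -
  \<comment> \<open>The state during both loops: \<open>u\<close> is the quotient so far,
    \<open>v\<close> the countdown, \<open>w\<close> the half of \<open>r\<close> so far.\<close>
  define S where "S u v w s \<longleftrightarrow>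
      (\<forall>x. x \<notin> {0, 1, 2, b + 14, b + 3, b + 4, b + 5, b + 10, b + 11} \<longrightarrow> reg s x = 0) \<and>
      reg s 0 = n \<and> reg s 1 = r \<and> reg s 2 = k \<and> mem s = (\<lambda>_ _. 0) \<and> out s = [] \<and>
      reg s (b + 14) = 1 \<and> reg s (b + 3) = n \<and> reg s (b + 4) = r \<and>
      reg s (b + 5) = u \<and> reg s (b + 10) = v \<and> reg s (b + 11) = w" for u v w and s :: state
  have t: "r * t \<le> 2 * k" "2 * k < r * Suc t" "t \<le> k"
  proof -
    show "r * t \<le> 2 * k" unfolding t_def by simp
    show "2 * k < r * Suc t" unfolding t_def using assms(2) dividend_less_times_div[of r "2 * k"] by simp
    have "2 * k div r \<le> 2 * k div 2" using assms(2) by (intro div_le_mono2) auto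
    then show "t \<le> k" unfolding t_def by simp
  qed
  have loop1: "wp (quotient_loop b)
      (\<lambda>s _. S t 0 0 s) s (3 * k + 1)" if "S 0 (2 * k + 1 - r) 0 s" for s
  proof (rule wp_conseq[of _ "\<lambda>s. S t (2 * k + 1 - r * Suc t) 0 s" _ "3 * t + 1"])
    show "wp (quotient_loop b)
      (\<lambda>s _. S t (2 * k + 1 - r * Suc t) 0 s) s (3 * t + 1)"
    proof (unfold quotient_loop_def, rule wp_While[where B = 2 and I = "\<lambda>i. S i (2 * k + 1 - r * Suc i) 0"])
      fix i s assume i: "i < t" "S i (2 * k + 1 - r * Suc i) 0 s"
      have "r * Suc i \<le> r * t" using i(1) by (intro mult_left_mono) auto
      then have "r * Suc i \<le> 2 * k" using t by linarith
      then show "reg s (b + 10) \<noteq> 0 \<and> wp (seq [Add (b + 5) (b + 5) (b + 14), Sub (b + 10) (b + 10) (b + 4)])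
          (\<lambda>s _. S (Suc i) (2 * k + 1 - r * Suc (Suc i)) 0 s) s 2"
        using i(2) assms(1) by (simp add: S_def)
    qed (use that t in \<open>simp_all add: S_def\<close>)
  qed (use t in auto)
  have loop2: "wp (halving_loop b) (\<lambda>s _. S t 0 (r div 2) s) s (4 * k + 1)" if "S t (r - 1) 0 s" for s
  proof (rule wp_conseq[of _ "\<lambda>s. S t (r - 1 - 2 * (r div 2)) (r div 2) s" _ "4 * (r div 2) + 1"])
    show "wp (halving_loop b) (\<lambda>s _. S t (r - 1 - 2 * (r div 2)) (r div 2) s) s (4 * (r div 2) + 1)"
    proof (unfold halving_loop_def, rule wp_While[where B = 3 and I = "\<lambda>i. S t (r - 1 - 2 * i) i"])
      fix i s assume i: "i < r div 2" "S t (r - 1 - 2 * i) i s"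
      then have "2 * i + 1 < r" by linarith
      then show "reg s (b + 10) \<noteq> 0 \<and> wp (seq [Add (b + 11) (b + 11) (b + 14), Sub (b + 10) (b + 10) (b + 14),
           Sub (b + 10) (b + 10) (b + 14)]) (\<lambda>s _. S t (r - 1 - 2 * Suc i) (Suc i) s) s 3"
        using i(2) assms(1) by (simp add: S_def)
    qed (use that in \<open>auto simp: S_def\<close>)
  next
    have "r - 1 - 2 * (r div 2) = 0" by linarith
    then show "\<And>s' R. S t (r - 1 - 2 * (r div 2)) (r div 2) s' \<Longrightarrow> S t 0 (r div 2) s'" by simp
  qed (use assms in auto)
  let ?post = "\<lambda>s :: state. (\<forall>x<b. reg s x = reg (init [r, k, max n t]) x) \<and>
     (\<forall>a. a \<noteq> b + 14 \<longrightarrow> mem s a = (\<lambda>_. 0)) \<and> mem s (b + 14) = (\<lambda>_. 0)(t + 1 := r div 2) \<and>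
     out s = [] \<and> reg s b = 0 \<and> reg s (b + 14) = 1 \<and> reg s (b + 3) = n \<and> reg s (b + 4) = r \<and>
     reg s (b + 5) = t \<and> reg s (b + 6) = max n t \<and> reg s (b + 7) = 0"
  define post where "post = ?post"
  have final: "post (set_reg 2 (n - t + t) (set_reg 1 k (set_reg 0 r (set_reg (b + 6) (n - t + t)
      (set_reg (b + 6) (n - t) (set_mem (b + 14) (t + 1) (r div 2) (set_reg (b + 10) (t + 1) s)))))))"
    if "S t 0 (r div 2) s" for s
  proof -
    have "n - t + t = max n t" by simp
    then show ?thesis using that assms(1) by (simp add: post_def S_def reg_init)
  qed
  have "wp (prepare b) (\<lambda>s _. post s) (init [n, r, k]) (7 * k + 16)"
    unfolding prepare_def
    apply simp
    apply (rule wp_conseq[OF loop1])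
      apply (use assms(1) in \<open>simp add: S_def reg_init\<close>)
     apply simp
    apply (simp only: wp_Seq wp_basic, rule conjI, simp)
    apply (rule wp_conseq[OF loop2])
      apply (simp add: S_def)
     apply simp
    subgoal premises prems for s1 R1 s2 R2
    proof -
      have "7 \<le> R2" using prems(2,4) by simp
      then obtain d where "R2 = 7 + d" using le_Suc_ex by blast
      then show ?thesis using prems(3) final[OF prems(3)] by (simp add: S_def)
    qed
    done
  then show ?thesis unfolding post_def .
qed

text \<open>The invariant part of the whole enumeration. Function \<open>i\<close> occupies a block
  of \<open>Suc N\<close> cells whose offset 0 holds the leading \<open>N\<close>.\<close>

definition context_ok :: "nat \<Rightarrow> nat \<Rightarrow> nat \<Rightarrow> nat \<Rightarrow> nat \<Rightarrow> (nat \<Rightarrow> nat) list \<Rightarrow> state \<Rightarrow> bool" where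
  "context_ok b n r t N hs s \<longleftrightarrow>
     reg s b = length hs * Suc N \<and> reg s (b + 14) = 1 \<and> reg s (b + 3) = n \<and> reg s (b + 4) = r \<and>
     reg s (b + 5) = t \<and> reg s (b + 6) = N \<and>
     (\<forall>i<length hs. \<forall>j\<in>{1..N}. mem s b (i * Suc N + j) = (hs ! i) j)"

lemma emit_values_spec:
  assumes "reg s (b + 14) = 1" "reg s (b + 10) = n"
  shows "wp (emit_values b) (\<lambda>s' _. mem s' = mem s \<and>
     out s' = out s @ map (\<lambda>i. mem s (b + 14) (mem s b (reg s (b + 11) + i))) [1..<Suc n] \<and>
     (\<forall>y. y \<notin> {b + 10, b + 11, b + 12} \<longrightarrow> reg s' y = reg s y)) s (6 * n + 1)"
proof (rule wp_conseq[OF _ order_refl])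
  let ?I = "\<lambda>i s'. mem s' = mem s \<and>
     out s' = out s @ map (\<lambda>i. mem s (b + 14) (mem s b (reg s (b + 11) + i))) [1..<Suc i] \<and>
     (\<forall>y. y \<notin> {b + 10, b + 11, b + 12} \<longrightarrow> reg s' y = reg s y) \<and>
     reg s' (b + 10) = n - i \<and> reg s' (b + 11) = reg s (b + 11) + i"
  show "wp (emit_values b) (\<lambda>s' _. ?I n s') s (6 * n + 1)"
    unfolding emit_values_def
    by (rule wp_While[where B = 5 and I = ?I]) (use assms in simp_all)
qed simp

lemma carry_loop_spec:
  assumes "reg s (b + 14) = 1" "reg s (b + 4) = r" "reg s (b + 10) = t" "reg s (b + 11) = 0"
    "reg s (b + 13) = 1" "\<forall>j\<in>{1..t + 1}. mem s (b + 14) j = cell r t x j"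
  shows "wp (carry_loop b) (\<lambda>s' _. (\<forall>a. a \<noteq> b + 14 \<longrightarrow> mem s' a = mem s a) \<and> out s' = out s \<and>
     (\<forall>y. y \<notin> {b + 10, b + 11, b + 12, b + 13} \<longrightarrow> reg s' y = reg s y) \<and>
     (\<forall>j\<in>{1..t + 1}. mem s' (b + 14) j = cell r t (Suc x) j) \<and>
     reg s' (b + 13) = (if (r + 1) ^ t dvd Suc x then 1 else 0)) s (9 * t + 1)"
proof (rule wp_conseq[OF _ order_refl])
  \<comment> \<open>After \<open>i\<close> rounds the lowest \<open>i\<close> digits belong to
    \<open>Suc x\<close> and the others still to \<open>x\<close>; the carry register holds the
    carry into digit \<open>i\<close>.\<close>
  let ?I = "\<lambda>i s'. (\<forall>a. a \<noteq> b + 14 \<longrightarrow> mem s' a = mem s a) \<and> out s' = out s \<and>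
     (\<forall>y. y \<notin> {b + 10, b + 11, b + 12, b + 13} \<longrightarrow> reg s' y = reg s y) \<and>
     (\<forall>j\<in>{1..t + 1}. mem s' (b + 14) j = cell r t (if j \<le> i then Suc x else x) j) \<and>
     reg s' (b + 13) = (if (r + 1) ^ i dvd Suc x then 1 else 0) \<and>
     reg s' (b + 10) = t - i \<and> reg s' (b + 11) = i"
  show "wp (carry_loop b) (\<lambda>s' _. ?I t s') s (9 * t + 1)"
    unfolding carry_loop_def
  proof (rule wp_While[where B = 8 and I = ?I])
    fix i and s' :: state assume i: "i < t" "?I i s'"
    define y where "y = cell r t x (Suc i) + (if (r + 1) ^ i dvd Suc x then 1 else 0)"
    have y: "cell r t (Suc x) (Suc i) = (if r < y then 0 else y)"
      "(r + 1) ^ Suc i dvd Suc x \<longleftrightarrow> r < y"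
      using cell_Suc[OF i(1), of r x] by (simp_all add: y_def Let_def)
    have "y \<le> Suc r" using cell_le[of r t x "Suc i"] by (simp add: y_def)
    have v: "mem s' (b + 14) (Suc i) + reg s' (b + 13) = y" using i by (simp add: y_def)
    have regs: "reg s' (b + 14) = 1" "reg s' (b + 4) = r" "reg s' (b + 10) = t - i" "reg s' (b + 11) = i"
      using i assms by simp_all
    show "reg s' (b + 10) \<noteq> 0 \<and> wp (carry_body b) (\<lambda>s'' _. ?I (Suc i) s'') s' 8"
    proof
      show "reg s' (b + 10) \<noteq> 0" using i(1) regs(3) by simp
      define J where "J s'' \<longleftrightarrow> (\<forall>a. a \<noteq> b + 14 \<longrightarrow> mem s'' a = mem s' a) \<and> out s'' = out s' \<and>
        mem s'' (b + 14) = (mem s' (b + 14))(Suc i := if r < y then 0 else y) \<and>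
        (\<forall>y. y \<notin> {b + 10, b + 11, b + 12, b + 13} \<longrightarrow> reg s'' y = reg s' y) \<and>
        reg s'' (b + 13) = y - r \<and> reg s'' (b + 10) = t - i - 1 \<and> reg s'' (b + 11) = Suc i" for s'' :: state
      have "wp (carry_body b) (\<lambda>s'' _. J s'') s' 8"
        using regs v by (simp add: carry_body_def J_def)
      moreover have "?I (Suc i) s''" if "J s''" for s''
      proof (intro conjI ballI)
        have "reg s'' (b + 13) = (if r < y then 1 else 0)"
          using that \<open>y \<le> Suc r\<close> by (auto simp: J_def)
        then show "reg s'' (b + 13) = (if (r + 1) ^ Suc i dvd Suc x then 1 else 0)"
          unfolding y(2) .
        fix j assume j: "j \<in> {1..t + 1}"
        have "mem s'' (b + 14) j = (if j = Suc i then cell r t (Suc x) (Suc i) else mem s' (b + 14) j)"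
          using that y(1) by (simp add: J_def)
        also have "\<dots> = cell r t (if j \<le> Suc i then Suc x else x) j"
          using i(2) j by (auto simp: le_Suc_eq simp del: atLeastAtMost_iff)
        finally show "mem s'' (b + 14) j = cell r t (if j \<le> Suc i then Suc x else x) j" .
      qed (use that i in \<open>simp_all add: J_def\<close>)
      ultimately show "wp (carry_body b) (\<lambda>s'' _. ?I (Suc i) s'') s' 8"
        by (rule wp_conseq[OF _ order_refl])
    qed
  qed (use assms in auto)
\<comment> \<open>The loop stops below colour \<open>t + 1\<close>, whose value
  \<open>r div 2\<close> is the same for \<open>x\<close> and \<open>Suc x\<close>.\<close>
qed (auto simp: cell_def)

text \<open>For \<open>j \<le> t\<close> the power is a multiple of
  \<open>(r + 1) ^ (j - 1) * (r + 1)\<close>. Thus the overflowing odometer shows the digits of 0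
  again.\<close>

lemma cell_power:
  assumes "j \<in> {1..t + 1}"
  shows "cell r t ((r + 1) ^ t) j = cell r t 0 j"
proof (cases "j \<le> t")
  case True
  define d where "d = t - j"
  have "t = (j - 1) + Suc d" using True assms by (simp add: d_def)
  then have "(r + 1) ^ t = (r + 1) ^ (j - 1) * ((r + 1) * (r + 1) ^ d)"
    by (simp only: power_add power_Suc)
  then show ?thesis using True by (simp add: cell_def del: One_nat_def)
qed (simp add: cell_def)

lemma encode_family_append: "encode_family n (xs @ ys) = encode_family n xs @ encode_family n ys"
  by (simp add: encode_family_def)

lemma colour_body_spec:
  assumes regs: "reg s (b + 14) = 1" "reg s (b + 3) = n" "reg s (b + 4) = r" "reg s (b + 5) = t"
    and cells: "\<forall>j\<in>{1..t + 1}. mem s (b + 14) j = cell r t x j"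
  shows "wp (colour_body b) (\<lambda>s' _. (\<forall>a. a \<noteq> b + 14 \<longrightarrow> mem s' a = mem s a) \<and>
     out s' = out s @ n # map (\<lambda>i. mem s (b + 14) (mem s b (reg s (b + 7) + i))) [1..<Suc n] \<and>
     (\<forall>y. y \<notin> {b + 9, b + 10, b + 11, b + 12, b + 13} \<longrightarrow> reg s' y = reg s y) \<and>
     (\<forall>j\<in>{1..t + 1}. mem s' (b + 14) j = cell r t (Suc x) j) \<and>
     reg s' (b + 9) = (if (r + 1) ^ t dvd Suc x then 0 else 1)) s (6 * n + 9 * t + 9)"
    (is "wp _ (\<lambda>s' _. ?J s') s _")
proof -
  define J where "J = ?J"
  define E where "E s' \<longleftrightarrow> mem s' = mem s \<and>
     out s' = out s @ n # map (\<lambda>i. mem s (b + 14) (mem s b (reg s (b + 7) + i))) [1..<Suc n] \<and>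
     (\<forall>y. y \<notin> {b + 10, b + 11, b + 12} \<longrightarrow> reg s' y = reg s y)" for s' :: state
  have emit: "wp (emit_values b) (\<lambda>s' _. E s')
      (set_reg (b + 11) (reg s (b + 7)) (set_reg (b + 10) n (s\<lparr>out := out s @ [n]\<rparr>))) (6 * n + 1)"
    by (rule wp_conseq[OF emit_values_spec[where n = n] order_refl]) (auto simp: E_def regs)
  have carry: "wp (carry_loop b) (\<lambda>s' _. J (set_reg (b + 9) (reg s' (b + 14) - reg s' (b + 13)) s'))
      (set_reg (b + 13) 1 (set_reg (b + 11) 0 (set_reg (b + 10) (reg s1 (b + 5)) s1))) (9 * t + 1)"
    if "E s1" for s1
    by (rule wp_conseq[OF carry_loop_spec[where r = r and t = t and x = x] order_refl])
      (use that regs cells in \<open>simp_all add: E_def J_def\<close>)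
  have "wp (colour_body b) (\<lambda>s' _. J s') s (6 * n + 9 * t + 9)"
    unfolding colour_body_def using regs
    apply simp
    apply (rule wp_conseq[OF emit])
     apply simp
    apply simp
    apply (rule conjI, simp)+
    apply (rule wp_conseq[OF carry[simplified]], assumption)
     apply simp
    apply simp
    done
  then show ?thesis unfolding J_def .
qed

lemma colour_loop_spec:
  assumes ctx: "context_ok b n r t N hs s" and i: "i < length hs" "n \<le> N"
    and h: "hs ! i \<in> {1..N} \<rightarrow> {1..t + 1}"
    and s: "reg s (b + 7) = i * Suc N" "reg s (b + 9) = 1"
      "\<forall>j\<in>{1..t + 1}. mem s (b + 14) j = cell r t 0 j"
  shows "wp (colour_loop b) (\<lambda>s' _. context_ok b n r t N hs s' \<and> reg s' (b + 7) = i * Suc N \<and>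
     (\<forall>j\<in>{1..t + 1}. mem s' (b + 14) j = cell r t 0 j) \<and>
     out s' = out s @ encode_family n (map (coloured n r t (hs ! i)) [0..<(r + 1) ^ t])) s
     ((r + 1) ^ t * (6 * n + 9 * t + 10) + 1)"
proof (rule wp_conseq[OF _ order_refl])
  let ?I = "\<lambda>x s'. context_ok b n r t N hs s' \<and> reg s' (b + 7) = i * Suc N \<and>
     (\<forall>j\<in>{1..t + 1}. mem s' (b + 14) j = cell r t x j) \<and>
     out s' = out s @ encode_family n (map (coloured n r t (hs ! i)) [0..<x]) \<and>
     reg s' (b + 9) = (if x < (r + 1) ^ t then 1 else 0)"
  show "wp (colour_loop b) (\<lambda>s' _. ?I ((r + 1) ^ t) s') s ((r + 1) ^ t * (6 * n + 9 * t + 10) + 1)"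
    unfolding colour_loop_def
  proof (rule wp_While[where B = "6 * n + 9 * t + 9" and I = ?I])
    fix x s0 assume x: "x < (r + 1) ^ t" "?I x s0"
    have regs: "reg s0 (b + 14) = 1" "reg s0 (b + 3) = n" "reg s0 (b + 4) = r" "reg s0 (b + 5) = t"
      using x(2) by (simp_all add: context_ok_def)
    \<comment> \<open>Two table lookups compose to \<open>coloured\<close>; since
      \<open>hs ! i\<close> takes values in \<open>{1..t + 1}\<close>, the second one stays within
      the maintained cells.\<close>
    have tab: "map (\<lambda>j. mem s0 (b + 14) (mem s0 b (i * Suc N + j))) [1..<Suc n] =
        map (coloured n r t (hs ! i) x) [1..<Suc n]"
    proof (rule map_cong[OF refl])
      fix j assume "j \<in> set [1..<Suc n]"
      then have j: "j \<in> {1..n}" "j \<in> {1..N}" using i(2) by auto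
      then have "mem s0 b (i * Suc N + j) = (hs ! i) j" using x(2) i(1) by (simp add: context_ok_def)
      moreover have "(hs ! i) j \<in> {1..t + 1}" using h j(2) by auto
      ultimately show "mem s0 (b + 14) (mem s0 b (i * Suc N + j)) = coloured n r t (hs ! i) x j"
        using x(2) j(1) by (simp add: coloured_def)
    qed
    \<comment> \<open>Within the range of the loop the power divides \<open>Suc x\<close> only if
      they are equal, so the final carry detects the last \<open>x\<close>.\<close>
    have dvd: "(r + 1) ^ t dvd Suc x \<longleftrightarrow> \<not> Suc x < (r + 1) ^ t"
      using x(1) by (cases "Suc x = (r + 1) ^ t") (auto dest: dvd_imp_le)
    show "reg s0 (b + 9) \<noteq> 0 \<and> wp (colour_body b) (\<lambda>s' _. ?I (Suc x) s') s0 (6 * n + 9 * t + 9)"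
    proof (intro conjI wp_conseq[OF colour_body_spec[OF regs] order_refl])
      fix s' :: state assume s': "(\<forall>a. a \<noteq> b + 14 \<longrightarrow> mem s' a = mem s0 a) \<and>
        out s' = out s0 @ n # map (\<lambda>i. mem s0 (b + 14) (mem s0 b (reg s0 (b + 7) + i))) [1..<Suc n] \<and>
        (\<forall>y. y \<notin> {b + 9, b + 10, b + 11, b + 12, b + 13} \<longrightarrow> reg s' y = reg s0 y) \<and>
        (\<forall>j\<in>{1..t + 1}. mem s' (b + 14) j = cell r t (Suc x) j) \<and>
        reg s' (b + 9) = (if (r + 1) ^ t dvd Suc x then 0 else 1)"
      then show "context_ok b n r t N hs s'" using x(2) by (simp add: context_ok_def)
      show "reg s' (b + 7) = i * Suc N" using s' x(2) by simp
      show "reg s' (b + 9) = (if Suc x < (r + 1) ^ t then 1 else 0)" using s' dvd by simp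
      have "out s' = out s0 @ n # map (coloured n r t (hs ! i) x) [1..<Suc n]"
        using s' x(2) tab by simp
      then show "out s' = out s @ encode_family n (map (coloured n r t (hs ! i)) [0..<Suc x])"
        using x(2) by (simp add: encode_family_def)
    qed (use x in auto)
  qed (use assms in \<open>auto simp: encode_family_def\<close>)
qed (use cell_power in auto)

lemma family_loop_spec:
  assumes ctx: "context_ok b n r t N hs s" and n: "n \<le> N"
    and h: "\<forall>h\<in>set hs. h \<in> {1..N} \<rightarrow> {1..t + 1}"
    and s: "reg s (b + 7) = 0" "reg s (b + 8) = length hs * Suc N"
      "\<forall>j\<in>{1..t + 1}. mem s (b + 14) j = cell r t 0 j"
  shows "wp (family_loop b) (\<lambda>s' _. out s' = out s @ encode_family n (coloured_family n r t hs)) s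
     (length hs * ((r + 1) ^ t * (6 * n + 9 * t + 10) + 6) + 1)"
proof (rule wp_conseq[OF _ order_refl])
  let ?I = "\<lambda>i s'. context_ok b n r t N hs s' \<and> reg s' (b + 7) = i * Suc N \<and>
     reg s' (b + 8) = length hs * Suc N - i * Suc N \<and>
     (\<forall>j\<in>{1..t + 1}. mem s' (b + 14) j = cell r t 0 j) \<and>
     out s' = out s @ encode_family n (coloured_family n r t (take i hs))"
  show "wp (family_loop b) (\<lambda>s' _. ?I (length hs) s') s (length hs * ((r + 1) ^ t * (6 * n + 9 * t + 10) + 6) + 1)"
    unfolding family_loop_def
  proof (rule wp_While[where B = "(r + 1) ^ t * (6 * n + 9 * t + 10) + 5" and I = ?I])
    fix i s0 assume i: "i < length hs" "?I i s0"
    \<comment> \<open>A block has at least one cell, so the remaining length is positive until all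
      functions have been treated.\<close>
    have "Suc i * Suc N \<le> length hs * Suc N" using i(1) by (intro mult_right_mono) auto
    then have "i * Suc N < length hs * Suc N" by simp
    show "reg s0 (b + 8) \<noteq> 0 \<and> wp (seq
      [SetC (b + 9) 1, colour_loop b, Add (b + 7) (b + 7) (b + 6), Add (b + 7) (b + 7) (b + 14),
       Sub (b + 8) b (b + 7)]) (\<lambda>s' _. ?I (Suc i) s') s0 ((r + 1) ^ t * (6 * n + 9 * t + 10) + 5)"
    proof -
      define J where "J s' \<longleftrightarrow> ?I (Suc i) s'" for s'
      have colour: "wp (colour_loop b) (\<lambda>s' _. J (set_reg (b + 8) (reg s' b - (reg s' (b + 7) + reg s' (b + 6) + reg s' (b + 14)))
          (set_reg (b + 7) (reg s' (b + 7) + reg s' (b + 6) + reg s' (b + 14))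
          (set_reg (b + 7) (reg s' (b + 7) + reg s' (b + 6)) s'))))
          (set_reg (b + 9) 1 s0) ((r + 1) ^ t * (6 * n + 9 * t + 10) + 1)"
      proof (rule wp_conseq[OF colour_loop_spec[where i = i and N = N and hs = hs] order_refl])
        show "context_ok b n r t N hs (set_reg (b + 9) 1 s0)" using i(2) by (simp add: context_ok_def)
      next
        fix s' assume s': "context_ok b n r t N hs s' \<and> reg s' (b + 7) = i * Suc N \<and>
           (\<forall>j\<in>{1..t + 1}. mem s' (b + 14) j = cell r t 0 j) \<and>
           out s' = out (set_reg (b + 9) 1 s0) @
             encode_family n (map (coloured n r t (hs ! i)) [0..<(r + 1) ^ t])"
        then show "J (set_reg (b + 8) (reg s' b - (reg s' (b + 7) + reg s' (b + 6) + reg s' (b + 14)))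
          (set_reg (b + 7) (reg s' (b + 7) + reg s' (b + 6) + reg s' (b + 14))
          (set_reg (b + 7) (reg s' (b + 7) + reg s' (b + 6)) s')))"
          using i by (simp add: J_def context_ok_def take_Suc_conv_app_nth coloured_family_snoc encode_family_append)
      qed (use i n h in auto)
      have "wp (seq [SetC (b + 9) 1, colour_loop b, Add (b + 7) (b + 7) (b + 6), Add (b + 7) (b + 7) (b + 14),
          Sub (b + 8) b (b + 7)]) (\<lambda>s' _. J s') s0 ((r + 1) ^ t * (6 * n + 9 * t + 10) + 5)"
        apply simp
        apply (rule wp_conseq[OF colour[simplified]])
         apply simp
        apply auto
        done
      then show ?thesis using i \<open>i * Suc N < length hs * Suc N\<close> by (simp add: J_def)
    qed
  qed (use assms in \<open>auto simp: encode_family_def coloured_family_def\<close>)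
qed simp

section \<open>Layout of the encoded family and total running time\<close>

lemma length_encode_family: "length (encode_family N hs) = length hs * Suc N"
  by (induction hs) (simp_all add: encode_family_def)

lemma nth_encode_family:
  assumes "i < length hs" "j \<in> {1..N}"
  shows "encode_family N hs ! (i * Suc N + j) = (hs ! i) j"
  using assms
proof (induction hs arbitrary: i)
  case (Cons h hs)
  have cons: "encode_family N (h # hs) = (N # map h [1..<Suc N]) @ encode_family N hs"
    by (simp add: encode_family_def)
  show ?case
  proof (cases i)
    case 0
    then show ?thesis using Cons.prems unfolding cons by (auto simp: nth_append nth_Cons' simp del: upt_Suc)
  next
    case (Suc i')
    then show ?thesis using Cons.IH[of i'] Cons.prems unfolding cons
      by (simp add: nth_append ac_simps del: upt_Suc)
  qed
qed simp

definition separator_prog :: "prog \<Rightarrow> prog" where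
  "separator_prog P = (let b = max 3 (width P) in
     seq [prepare b, redirect b P, Copy (b + 8) b, family_loop b])"

lemma separator_prog_spec:
  assumes "1 < r" "r \<le> k" and t: "t = 2 * k div r" and N: "N = max n t"
    and P: "exec P (init [r, k, N]) m sP" "out sP = encode_family N hs"
    and h: "\<forall>h\<in>set hs. h \<in> {1..N} \<rightarrow> {1..t + 1}"
  shows "wp (separator_prog P) (\<lambda>s _. out s = encode_family n (coloured_family n r t hs)) (init [n, r, k])
     (7 * k + 18 + 2 * m + length hs * ((r + 1) ^ t * (6 * n + 9 * t + 10) + 6))"
proof -
  define b where "b = max 3 (width P)"
  then have b: "3 \<le> b" "width P \<le> b" by auto
  define ready where "ready s \<longleftrightarrow> (\<forall>x<b. reg s x = reg (init [r, k, N]) x) \<and>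
     (\<forall>a. a \<noteq> b + 14 \<longrightarrow> mem s a = (\<lambda>_. 0)) \<and> mem s (b + 14) = (\<lambda>_. 0)(t + 1 := r div 2) \<and>
     out s = [] \<and> reg s b = 0 \<and> reg s (b + 14) = 1 \<and> reg s (b + 3) = n \<and> reg s (b + 4) = r \<and>
     reg s (b + 5) = t \<and> reg s (b + 6) = N \<and> reg s (b + 7) = 0" for s :: state
  define finished where "finished s \<longleftrightarrow> out s = encode_family n (coloured_family n r t hs)" for s :: state
  let ?T = "length hs * ((r + 1) ^ t * (6 * n + 9 * t + 10) + 6) + 1"
  have prepare: "wp (prepare b) (\<lambda>s _. ready s) (init [n, r, k]) (7 * k + 16)"
    using prepare_spec[OF b(1) assms(1,2), of n] unfolding ready_def t N .
  \<comment> \<open>Below index \<open>b\<close> the prepared state looks like the initial state of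
    \<open>P\<close>, and a zero in register \<open>b\<close> represents the empty output. The
    prepared state is also its own frame.\<close>
  have run: "wp (redirect b P) (\<lambda>s _. simulates b s1 sP s) s1 (2 * m)" if "ready s1" for s1
  proof -
    have "simulates b s1 (init [r, k, N]) s1" "reg s1 (b + 14) = 1"
      using that by (auto simp: ready_def simulates_def)
    with redirect_simulates[OF P(1) b(2)] show ?thesis unfolding wp_def by blast
  qed
  have family: "wp (family_loop b) (\<lambda>s _. finished s) (set_reg (b + 8) (reg s2 b) s2) ?T"
    if "ready s1" "simulates b s1 sP s2" for s1 s2
  proof -
    let ?s = "set_reg (b + 8) (reg s2 b) s2"
    have tab: "reg s2 b = length hs * Suc N"
      "\<forall>i<length (encode_family N hs). mem s2 b i = encode_family N hs ! i"
      using that(2) P(2) by (simp_all add: simulates_def length_encode_family)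
    have "mem s2 b (i * Suc N + j) = (hs ! i) j" if "i < length hs" "j \<in> {1..N}" for i j
    proof -
      have "Suc i * Suc N \<le> length hs * Suc N" using that(1) by (intro mult_right_mono) auto
      then have "i * Suc N + j < length (encode_family N hs)"
        using that(2) by (simp add: length_encode_family)
      then show ?thesis using tab(2) nth_encode_family[OF that] by simp
    qed
    then have ctx: "context_ok b n r t N hs ?s"
      using that tab(1) by (simp add: context_ok_def simulates_def ready_def)
    have cells: "\<forall>j\<in>{1..t + 1}. mem ?s (b + 14) j = cell r t 0 j"
      using that by (auto simp: simulates_def ready_def cell_def)
    have "reg ?s (b + 7) = 0" "out ?s = []" using that by (simp_all add: simulates_def ready_def)
    with family_loop_spec[OF ctx _ h _ _ cells] tab(1) N show ?thesis by (simp add: finished_def)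
  qed
  have "wp (seq [prepare b, redirect b P, Copy (b + 8) b, family_loop b]) (\<lambda>s _. finished s) (init [n, r, k])
     (7 * k + 16 + (2 * m + (1 + ?T)))"
    unfolding seq.simps wp_Seq
    apply (rule wp_conseq[OF prepare], simp)
    apply (rule wp_conseq[OF run], assumption, simp)
    apply (simp only: wp_basic, rule conjI, simp)
    apply (rule wp_conseq[OF family], assumption, assumption)
     apply auto
    done
  then show ?thesis by (simp add: separator_prog_def finished_def b_def Let_def add_ac)
qed

text \<open>From \<open>n \<le> N\<close> and \<open>t \<le> N\<close> one output round costs at
  most \<open>15 * Suc N\<close>, and \<open>L * Suc N \<le> m\<close> turns the sum over all
  functions into a multiple of \<open>m * B\<close>. The exponent 6 comes from
  \<open>7 * k + 41 \<le> k * 2 ^ 5\<close> and \<open>2 \<le> k\<close>.\<close>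

lemma separator_time_bound:
  fixes m k B :: nat
  assumes "2 \<le> k" "1 \<le> m" "1 \<le> B" "L * Suc N \<le> m" "n \<le> N" "t \<le> N"
  shows "7 * k + 18 + 2 * m + L * (B * (6 * n + 9 * t + 10) + 6) \<le> k ^ 6 * m * B"
proof -
  have "L * (B * (6 * n + 9 * t + 10) + 6) \<le> L * (B * (15 * Suc N) + 6 * B)"
    using assms by (intro mult_left_mono add_mono) auto
  also have "\<dots> \<le> 21 * B * (L * Suc N)" by (simp add: algebra_simps)
  also have "\<dots> \<le> 21 * B * m" using assms(4) by (intro mult_left_mono) auto
  finally have "7 * k + 18 + 2 * m + L * (B * (6 * n + 9 * t + 10) + 6) \<le> 7 * k + 18 + 2 * m + 21 * B * m"
    by simp
  also have "\<dots> \<le> (7 * k + 18) * (m * B) + 2 * (m * B) + 21 * B * m"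
    using assms mult_le_mono[of 1 m 1 B] mult_le_mono2[of 1 B m] mult_le_mono2[of 1 "m * B" "7 * k + 18"]
    by (intro add_mono) auto
  also have "\<dots> = (7 * k + 41) * (m * B)" by (simp add: algebra_simps)
  also have "\<dots> \<le> (k * 2 ^ 5) * (m * B)" using assms(1) by (intro mult_right_mono) auto
  also have "\<dots> \<le> (k * k ^ 5) * (m * B)" using assms(1) by (intro mult_right_mono mult_left_mono power_mono) auto
  finally show ?thesis by (simp add: mult_ac power_numeral_reduce)
qed

theorem theorem3p3:
  "\<exists>c::nat. \<forall>P::prog. \<exists>Q::prog.
     \<forall>(n::nat) (r::nat) (k::nat) (t::nat)
      (f :: nat \<Rightarrow> nat \<Rightarrow> nat \<Rightarrow> real) (H :: nat \<Rightarrow> (nat \<Rightarrow> nat) list).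
       1 < r \<and> r \<le> k \<and> t = 2 * k div r \<and>
       (\<forall>N\<ge>1. minimal_separating t k N (set (H N)) \<and>
               computes_within P [r, k, N] (encode_family N (H N)) (f r k N))
       \<longrightarrow>
       (\<exists>F :: (nat \<Rightarrow> nat) list.
          separator n r k (set F) \<and>
          length F = length (H (max n t)) * (r + 1) ^ t \<and>
          computes_within Q [n, r, k] (encode_family n F)
            (real k ^ c * f r k (max n t) * (real r + 1) ^ t))"
proof (rule exI[of _ 6], rule allI, rule exI[of _ "separator_prog P" for P], intro allI impI, elim conjE)
  fix P :: prog and n r k t :: nat and f :: "nat \<Rightarrow> nat \<Rightarrow> nat \<Rightarrow> real" and H :: "nat \<Rightarrow> (nat \<Rightarrow> nat) list"
  assume r: "1 < r" "r \<le> k" and t: "t = 2 * k div r"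
    and H: "\<forall>N\<ge>1. minimal_separating t k N (set (H N)) \<and>
               computes_within P [r, k, N] (encode_family N (H N)) (f r k N)"
  define N where "N = max n t"
  let ?F = "coloured_family n r t (H N)"
  \<comment> \<open>This makes \<open>N\<close> positive; families are only given for
    \<open>N \<ge> 1\<close>, while \<open>n\<close> may be 0.\<close>
  have "1 \<le> t" using r by (simp add: t less_eq_div_iff_mult_less_eq)
  then have sep: "minimal_separating t k N (set (H N))"
    and "computes_within P [r, k, N] (encode_family N (H N)) (f r k N)"
    using H by (auto simp: N_def)
  then obtain m sP where P: "exec P (init [r, k, N]) m sP" "out sP = encode_family N (H N)"
    and m: "real m \<le> f r k N"
    unfolding computes_within_def by blast
  have "\<forall>h\<in>set (H N). h \<in> {1..N} \<rightarrow> {1..t + 1}"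
    using sep by (auto simp: minimal_separating_def PiE_iff)
  from separator_prog_spec[OF r t N_def P this] obtain m' s where
    run: "exec (separator_prog P) (init [n, r, k]) m' s" "out s = encode_family n ?F"
    and m': "m' \<le> 7 * k + 18 + 2 * m + length (H N) * ((r + 1) ^ t * (6 * n + 9 * t + 10) + 6)"
    unfolding wp_def by blast
  have "length (H N) * Suc N \<le> m" using length_out_le[OF P(1)] P(2) by (simp add: length_encode_family)
  then have "m' \<le> k ^ 6 * m * (r + 1) ^ t"
    using separator_time_bound[of k m "(r + 1) ^ t" "length (H N)" N n t] r exec_time_pos[OF P(1)] m'
    by (simp add: N_def)
  then have "real m' \<le> real (k ^ 6 * m * (r + 1) ^ t)" by (rule of_nat_mono)
  also have "\<dots> = real k ^ 6 * real m * (real r + 1) ^ t" by (simp add: add.commute)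
  also have "\<dots> \<le> real k ^ 6 * f r k N * (real r + 1) ^ t"
    using m by (intro mult_right_mono mult_left_mono) auto
  finally have "computes_within (separator_prog P) [n, r, k] (encode_family n ?F)
      (real k ^ 6 * f r k N * (real r + 1) ^ t)"
    using run unfolding computes_within_def by blast
  with separator_coloured_family[OF r(1) t N_def sep] length_coloured_family
  show "\<exists>F. separator n r k (set F) \<and> length F = length (H (max n t)) * (r + 1) ^ t \<and>
      computes_within (separator_prog P) [n, r, k] (encode_family n F)
        (real k ^ 6 * f r k (max n t) * (real r + 1) ^ t)"
    unfolding N_def by blast
qed

end
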